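(* Let $R$ be a commutative ring with identity, let $S$ be a multiplicative subset of $R$, and let $M$ be an $S$-faithful $R$-module. If $M$ is a uniformly $S$-Noetherian $R$-module, then $R$ is a uniformly $S$-Noetherian ring.
   Context: All rings are commutative with identity and all modules are unitary. A multiplicative subset $S$ of $R$ is a subset with $1\in S$ and $s_1s_2\in S$ for all $s_1,s_2\in S$. $\operatorname{Ann}_R(M)=\{r\in R\mid rM=0\}$. An $R$-module $M$ is $S$-faithful if $t\operatorname{Ann}_R(M)=0$ for some $t\in S$. For $s\in S$, an $R$-module $N$ is $s$-finite if there is a finitely generated $R$-submodule $F$ of $N$ with $sN\subseteq F\subseteq N$. An $R$-module $M$ is uniformly $S$-Noetherian if there exists a single element $s\in S$ such that every submodule of $M$ is $s$-finite. The ring $R$ is a uniformly $S$-Noetherian ring if $R$ is uniformly $S$-Noetherian as an $R$-module. *)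

theory Defs
  imports "HOL-Algebra.Module" "HOL-Algebra.Ideal"
begin

definition annihilator ::
    "('a, 'm) ring_scheme \<Rightarrow> ('a, 'b, 'n) module_scheme \<Rightarrow> 'a set"
  where "annihilator R M =
    {r \<in> carrier R. \<forall>x \<in> carrier M. r \<odot>\<^bsub>M\<^esub> x = \<zero>\<^bsub>M\<^esub>}"

definition S_faithful ::
    "('a, 'm) ring_scheme \<Rightarrow> 'a set \<Rightarrow> ('a, 'b, 'n) module_scheme \<Rightarrow> bool"
  where "S_faithful R S M \<longleftrightarrow>
    (\<exists>t \<in> S. (\<lambda>r. t \<otimes>\<^bsub>R\<^esub> r) ` annihilator R M = {\<zero>\<^bsub>R\<^esub>})"

definition gen_submodule ::
    "('a, 'm) ring_scheme \<Rightarrow> ('a, 'b, 'n) module_scheme \<Rightarrow> 'b set \<Rightarrow> 'b set"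
  where "gen_submodule R M X = \<Inter>{H. submodule H R M \<and> X \<subseteq> H}"

definition fg_submodule ::
    "'b set \<Rightarrow> ('a, 'm) ring_scheme \<Rightarrow> ('a, 'b, 'n) module_scheme \<Rightarrow> bool"
  where "fg_submodule F R M \<longleftrightarrow>
    submodule F R M \<and>
    (\<exists>X. finite X \<and> X \<subseteq> carrier M \<and> F = gen_submodule R M X)"

definition s_finite ::
    "('a, 'm) ring_scheme \<Rightarrow> 'a \<Rightarrow> ('a, 'b, 'n) module_scheme \<Rightarrow> bool"
  where "s_finite R s N \<longleftrightarrow>
    (\<exists>F. fg_submodule F R N \<and> (\<lambda>x. s \<odot>\<^bsub>N\<^esub> x) ` carrier N \<subseteq> F)"

text \<open>A submodule, given as a subset \<open>H\<close> of the carrier of \<open>M\<close>, is regarded as a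
  module in its own right by restricting the carrier of \<open>M\<close> to \<open>H\<close>.\<close>

definition uniformly_S_Noetherian ::
    "('a, 'm) ring_scheme \<Rightarrow> 'a set \<Rightarrow> ('a, 'b, 'n) module_scheme \<Rightarrow> bool"
  where "uniformly_S_Noetherian R S M \<longleftrightarrow>
    (\<exists>s \<in> S. \<forall>H. submodule H R M \<longrightarrow> s_finite R s (M\<lparr>carrier := H\<rparr>))"

text \<open>The ring \<open>R\<close> as a module over itself. The fields \<open>mult\<close> and \<open>one\<close> occur only
  because the record type of modules extends that of rings; the locale of modules
  ignores them.\<close>

definition regular_module :: "('a, 'm) ring_scheme \<Rightarrow> ('a, 'a) module"
  where "regular_module R =
    \<lparr>carrier = carrier R, mult = mult R, one = one R,
     zero = zero R, add = add R, smult = mult R\<rparr>"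

definition uniformly_S_Noetherian_ring :: "('a, 'm) ring_scheme \<Rightarrow> 'a set \<Rightarrow> bool"
  where "uniformly_S_Noetherian_ring R S \<longleftrightarrow>
    uniformly_S_Noetherian R S (regular_module R)"

lemma (in cring) module_regular_module: "module R (regular_module R)"
proof (rule moduleI)
  show "abelian_group (regular_module R)"
    by (rule abelian_groupI)
      (auto simp: regular_module_def add.m_ac intro: l_neg a_inv_closed)
qed (auto simp: regular_module_def cring_axioms l_distr r_distr m_assoc)

lemma (in module) gen_submodule_is_submodule:
  assumes "X \<subseteq> carrier M"
  shows "submodule (gen_submodule R M X) R M"
proof (rule submoduleI)
  show "gen_submodule R M X \<subseteq> carrier M"
    using carrier_is_submodule assms by (auto simp: gen_submodule_def)
  show "\<zero>\<^bsub>M\<^esub> \<in> gen_submodule R M X"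
    unfolding gen_submodule_def
    using subgroup.one_closed submodule.axioms(1) by fastforce
qed (auto simp: gen_submodule_def dest: submoduleE(3-5))

end

theory Submission
  imports Defs
begin

text \<open>
  Let \<open>s \<in> S\<close> witness that \<open>M\<close> is uniformly \<open>S\<close>-Noetherian, and choose finitely many elements
  \<open>x\<^sub>1, \<dots>, x\<^sub>n\<close> of \<open>M\<close> such that \<open>sM \<subseteq> \<langle>x\<^sub>1, \<dots>, x\<^sub>n\<rangle>\<close>.  If \<open>r \<in> R\<close> kills all the
  \<open>x\<^sub>i\<close>, then \<open>r s\<close> annihilates \<open>M\<close>, so \<open>t s r = 0\<close>, where \<open>t \<in> S\<close> witnesses
  \<open>S\<close>-faithfulness.  Thus, up to the factor \<open>t s\<close>, the map \<open>R \<rightarrow> M\<^sup>n\<close>,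
  \<open>r \<mapsto> (r x\<^sub>1, \<dots>, r x\<^sub>n)\<close>, is injective, and \<open>R\<close> inherits the Noetherian property
  from the image.

  The power \<open>M\<^sup>n\<close> need not be formed.  What is required of it is that, for some \<open>k \<in> S\<close>, every
  ideal \<open>I\<close> contains a finite set \<open>A\<close> such that each \<open>k a\<close> with \<open>a \<in> I\<close> agrees modulo the
  ideal generated by \<open>A\<close> with an element killing all the \<open>x\<^sub>i\<close>.  This is
  \<open>ideal_finite_modulo_annihilators\<close>, proved with \<open>k = s\<^sup>n\<close> by adding the \<open>x\<^sub>i\<close> one at a
  time: only elements of \<open>I\<close> that kill the previous \<open>x\<^sub>i\<close> remain to be treated, they form an
  ideal \<open>J\<close>, and \<open>J x\<close>, for the new element \<open>x\<close>, is a submodule of \<open>M\<close> and hence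
  \<open>s\<close>-finite (\<open>ideal_finite_on_element\<close>).  Since \<open>k\<close> does not depend on \<open>I\<close>, the element
  \<open>t s k\<close> works for all ideals of \<open>R\<close> at once.
\<close>

section \<open>Submodules of submodules and of the regular module\<close>

text \<open>Closure under negation comes for free, because \<open>- x = (- 1) x\<close>.  In particular the
  conditions do not mention the inverse operation, which depends on the carrier of \<open>M\<close>.\<close>

lemma (in module) submodule_iff_closed:
  "submodule H R M \<longleftrightarrow>
     H \<subseteq> carrier M \<and> \<zero>\<^bsub>M\<^esub> \<in> H \<and> (\<forall>x\<in>H. \<forall>y\<in>H. x \<oplus>\<^bsub>M\<^esub> y \<in> H) \<and>
     (\<forall>a\<in>carrier R. \<forall>x\<in>H. a \<odot>\<^bsub>M\<^esub> x \<in> H)" (is "_ \<longleftrightarrow> ?closed")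
proof
  assume "submodule H R M"
  then show ?closed
    using submoduleE(1,4,5) subgroup.one_closed submodule.axioms(1) by fastforce
next
  assume H: ?closed
  show "submodule H R M"
  proof (rule submoduleI)
    fix x assume x: "x \<in> H"
    with H have "(\<ominus> \<one>) \<odot>\<^bsub>M\<^esub> x \<in> H" by blast
    moreover have "(\<ominus> \<one>) \<odot>\<^bsub>M\<^esub> x = \<ominus>\<^bsub>M\<^esub> x"
      using H x by (subst smult_l_minus) auto
    ultimately show "\<ominus>\<^bsub>M\<^esub> x \<in> H" by simp
  qed (use H in auto)
qed

lemma (in module) submodule_restrict_iff:
  assumes "submodule H R M"
  shows "submodule K R (M\<lparr>carrier := H\<rparr>) \<longleftrightarrow> submodule K R M \<and> K \<subseteq> H"
proof -
  interpret N: module R "M\<lparr>carrier := H\<rparr>"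
    using submodule.submodule_is_module[OF assms] module_axioms by blast
  show ?thesis
    using submoduleE(1)[OF assms] by (auto simp: N.submodule_iff_closed submodule_iff_closed)
qed

lemma (in module) gen_submodule_restrict:
  assumes H: "submodule H R M" and X: "X \<subseteq> H"
  shows "gen_submodule R (M\<lparr>carrier := H\<rparr>) X = gen_submodule R M X"
proof
  show "gen_submodule R M X \<subseteq> gen_submodule R (M\<lparr>carrier := H\<rparr>) X"
    by (auto simp: gen_submodule_def submodule_restrict_iff[OF H])
next
  have "submodule (K \<inter> H) R M" if "submodule K R M" for K
    using that H by (auto simp: submodule_iff_closed)
  then have "gen_submodule R (M\<lparr>carrier := H\<rparr>) X \<subseteq> K" if "submodule K R M" "X \<subseteq> K" for K
    using that X unfolding gen_submodule_def submodule_restrict_iff[OF H] by blast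
  then show "gen_submodule R (M\<lparr>carrier := H\<rparr>) X \<subseteq> gen_submodule R M X"
    unfolding gen_submodule_def[of R M] by blast
qed

lemma (in module) gen_submodule_least:
  assumes "submodule H R M" "X \<subseteq> H"
  shows "gen_submodule R M X \<subseteq> H"
  using assms by (auto simp: gen_submodule_def)

text \<open>Generators of a submodule \<open>H\<close> span the same set in \<open>H\<close> as in \<open>M\<close>, so \<open>s\<close>-finiteness of \<open>H\<close>
  can be tested inside \<open>M\<close>.\<close>

lemma (in module) s_finite_restrict_iff:
  assumes H: "submodule H R M"
  shows "s_finite R s (M\<lparr>carrier := H\<rparr>) \<longleftrightarrow>
    (\<exists>X. finite X \<and> X \<subseteq> H \<and> (\<forall>x\<in>H. s \<odot>\<^bsub>M\<^esub> x \<in> gen_submodule R M X))"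
proof -
  have "fg_submodule F R (M\<lparr>carrier := H\<rparr>) \<longleftrightarrow>
      (\<exists>X. finite X \<and> X \<subseteq> H \<and> F = gen_submodule R M X)" for F
    using gen_submodule_restrict[OF H] gen_submodule_least[OF H]
      gen_submodule_is_submodule submoduleE(1)[OF H]
    by (auto simp: fg_submodule_def submodule_restrict_iff[OF H])
  then show ?thesis
    unfolding s_finite_def by (simp add: image_subset_iff) metis
qed

lemma (in cring) submodule_regular_module_iff:
  "submodule I R (regular_module R) \<longleftrightarrow> ideal I R"
proof
  interpret N: module R "regular_module R" by (rule module_regular_module)
  assume I: "submodule I R (regular_module R)"
  have "subgroup I (add_monoid R)"
    using submodule.axioms(1)[OF I]
    by (simp add: regular_module_def subgroup_def m_inv_def)
  moreover have "x \<otimes> a \<in> I" "a \<otimes> x \<in> I" if "a \<in> I" "x \<in> carrier R" for a x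
  proof -
    show "x \<otimes> a \<in> I"
      using I that unfolding N.submodule_iff_closed by (auto simp: regular_module_def)
    moreover have "a \<in> carrier R"
      using I that unfolding N.submodule_iff_closed by (auto simp: regular_module_def)
    ultimately show "a \<otimes> x \<in> I"
      using that by (simp add: m_comm)
  qed
  ultimately show "ideal I R"
    by (intro idealI ring_axioms)
next
  interpret N: module R "regular_module R" by (rule module_regular_module)
  assume "ideal I R"
  then interpret ideal I R .
  show "submodule I R (regular_module R)"
    unfolding N.submodule_iff_closed by (auto simp: regular_module_def I_l_closed)
qed

lemma (in cring) gen_submodule_regular_module:
  "gen_submodule R (regular_module R) X = Idl X"
  by (simp add: gen_submodule_def genideal_def submodule_regular_module_iff)

section \<open>Annihilators and orbits of elements\<close>

lemma (in module) submodule_killed_by: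
  assumes "r \<in> carrier R"
  shows "submodule {x \<in> carrier M. r \<odot>\<^bsub>M\<^esub> x = \<zero>\<^bsub>M\<^esub>} R M"
proof -
  have "r \<odot>\<^bsub>M\<^esub> (a \<odot>\<^bsub>M\<^esub> x) = a \<odot>\<^bsub>M\<^esub> (r \<odot>\<^bsub>M\<^esub> x)" if "a \<in> carrier R" "x \<in> carrier M" for a x
    using that assms by (metis R.m_comm smult_assoc1)
  then show ?thesis
    using assms by (auto simp: submodule_iff_closed smult_r_distr)
qed

lemma (in module) ideal_annihilating_elements:
  assumes I: "ideal I R" and X: "X \<subseteq> carrier M"
  shows "ideal {a \<in> I. \<forall>x\<in>X. a \<odot>\<^bsub>M\<^esub> x = \<zero>\<^bsub>M\<^esub>} R"
proof -
  interpret I: ideal I R by (rule I)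
  interpret N: module R "regular_module R" by (rule module_regular_module)
  have "submodule {a \<in> I. \<forall>x\<in>X. a \<odot>\<^bsub>M\<^esub> x = \<zero>\<^bsub>M\<^esub>} R (regular_module R)"
    unfolding N.submodule_iff_closed
    using X I.I_l_closed I.Icarr
    by (auto simp: regular_module_def smult_l_distr smult_assoc1 subset_iff)
  then show ?thesis
    by (simp add: submodule_regular_module_iff)
qed

lemma (in module) submodule_ideal_smult_element:
  assumes I: "ideal I R" and x: "x \<in> carrier M"
  shows "submodule ((\<lambda>a. a \<odot>\<^bsub>M\<^esub> x) ` I) R M"
proof -
  interpret I: ideal I R by (rule I)
  have "a \<odot>\<^bsub>M\<^esub> x \<oplus>\<^bsub>M\<^esub> b \<odot>\<^bsub>M\<^esub> x \<in> (\<lambda>a. a \<odot>\<^bsub>M\<^esub> x) ` I" if "a \<in> I" "b \<in> I" for a b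
    using that x by (intro image_eqI[of _ _ "a \<oplus> b"]) (auto simp: smult_l_distr)
  moreover have "r \<odot>\<^bsub>M\<^esub> (a \<odot>\<^bsub>M\<^esub> x) \<in> (\<lambda>a. a \<odot>\<^bsub>M\<^esub> x) ` I" if "r \<in> carrier R" "a \<in> I" for r a
    using that x by (intro image_eqI[of _ _ "r \<otimes> a"]) (auto simp: smult_assoc1 I.I_l_closed)
  moreover have "\<zero>\<^bsub>M\<^esub> \<in> (\<lambda>a. a \<odot>\<^bsub>M\<^esub> x) ` I"
    using x by (intro image_eqI[of _ _ \<zero>]) auto
  ultimately show ?thesis
    using x by (auto simp: submodule_iff_closed)
qed

section \<open>Finite generation of ideals modulo annihilators\<close>

text \<open>Here finite generation passes from \<open>M\<close> to \<open>R\<close>: finitely many generators of the submodule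
  \<open>I x\<close>, up to \<open>s\<close>, have the form \<open>b x\<close> with \<open>b \<in> I\<close>, and these \<open>b\<close> form \<open>B\<close>.\<close>

lemma (in module) ideal_finite_on_element:
  assumes s_fin: "\<And>H. submodule H R M \<Longrightarrow> s_finite R s (M\<lparr>carrier := H\<rparr>)"
    and I: "ideal I R" and x: "x \<in> carrier M"
  shows "\<exists>B. finite B \<and> B \<subseteq> I \<and> (\<forall>a\<in>I. \<exists>c\<in>Idl B. s \<odot>\<^bsub>M\<^esub> (a \<odot>\<^bsub>M\<^esub> x) = c \<odot>\<^bsub>M\<^esub> x)"
proof -
  interpret I: ideal I R by (rule I)
  note orbit = submodule_ideal_smult_element[OF _ x]
  obtain Y where Y: "finite Y" "Y \<subseteq> (\<lambda>a. a \<odot>\<^bsub>M\<^esub> x) ` I"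
    and gen: "\<And>a. a \<in> I \<Longrightarrow> s \<odot>\<^bsub>M\<^esub> (a \<odot>\<^bsub>M\<^esub> x) \<in> gen_submodule R M Y"
    using s_fin[OF orbit[OF I]] unfolding s_finite_restrict_iff[OF orbit[OF I]] by auto
  obtain B where B: "finite B" "B \<subseteq> I" "Y = (\<lambda>b. b \<odot>\<^bsub>M\<^esub> x) ` B"
    using finite_subset_image[OF Y] by blast
  have B_carrier: "B \<subseteq> carrier R"
    using B(2) I.Icarr by blast
  have "gen_submodule R M Y \<subseteq> (\<lambda>c. c \<odot>\<^bsub>M\<^esub> x) ` (Idl B)"
    using genideal_self[OF B_carrier]
    by (intro gen_submodule_least orbit genideal_ideal B_carrier) (auto simp: B(3))
  then have "\<exists>c\<in>Idl B. s \<odot>\<^bsub>M\<^esub> (a \<odot>\<^bsub>M\<^esub> x) = c \<odot>\<^bsub>M\<^esub> x" if "a \<in> I" for a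
    using gen[OF that] by (meson imageE subsetD)
  with B(1,2) show ?thesis
    by (intro exI[of _ B]) simp
qed

text \<open>The case of several elements stands in for the module \<open>M\<^sup>n\<close>.  The multiplier \<open>k\<close> is chosen
  before the ideal \<open>I\<close>, as the uniformity of the final conclusion demands; this costs nothing,
  because each new element only contributes one more factor \<open>s\<close>.\<close>

lemma (in module) ideal_finite_modulo_annihilators:
  assumes S: "submonoid S R" and s: "s \<in> S"
    and s_fin: "\<And>H. submodule H R M \<Longrightarrow> s_finite R s (M\<lparr>carrier := H\<rparr>)"
    and "finite X" "X \<subseteq> carrier M"
  shows "\<exists>k\<in>S. \<forall>I. ideal I R \<longrightarrow>
    (\<exists>A. finite A \<and> A \<subseteq> I \<and> (\<forall>a\<in>I. \<exists>b\<in>Idl A. \<forall>x\<in>X. (k \<otimes> a \<ominus> b) \<odot>\<^bsub>M\<^esub> x = \<zero>\<^bsub>M\<^esub>))"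
  using assms(4,5)
proof (induction X rule: finite_induct)
  case empty
  have "\<zero> \<in> Idl {}"
    by (rule additive_subgroup.zero_closed[OF ideal.axioms(1)[OF genideal_ideal]]) simp
  then have "\<exists>A. finite A \<and> A \<subseteq> I \<and>
      (\<forall>a\<in>I. \<exists>b\<in>Idl A. \<forall>x\<in>{}. (\<one> \<otimes> a \<ominus> b) \<odot>\<^bsub>M\<^esub> x = \<zero>\<^bsub>M\<^esub>)" for I
    by (intro exI[of _ "{}"]) blast
  then show ?case
    using submonoid.one_closed[OF S] by blast
next
  case (insert x X)
  have X: "X \<subseteq> carrier M" and x: "x \<in> carrier M"
    using insert.prems by auto
  obtain k where k: "k \<in> S" and step: "\<And>I. ideal I R \<Longrightarrow> \<exists>A. finite A \<and> A \<subseteq> I \<and>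
      (\<forall>a\<in>I. \<exists>b\<in>Idl A. \<forall>y\<in>X. (k \<otimes> a \<ominus> b) \<odot>\<^bsub>M\<^esub> y = \<zero>\<^bsub>M\<^esub>)"
    using insert.IH[OF X] by blast
  have sR: "s \<in> carrier R" and kR: "k \<in> carrier R"
    using s k submonoid.subset[OF S] by auto
  have "\<exists>A. finite A \<and> A \<subseteq> I \<and>
      (\<forall>a\<in>I. \<exists>b\<in>Idl A. \<forall>y\<in>insert x X. ((s \<otimes> k) \<otimes> a \<ominus> b) \<odot>\<^bsub>M\<^esub> y = \<zero>\<^bsub>M\<^esub>)"
    if I: "ideal I R" for I
  proof -
    interpret I: ideal I R by (rule I)
    obtain A where A: "finite A" "A \<subseteq> I"
      and A_gen: "\<And>a. a \<in> I \<Longrightarrow> \<exists>b\<in>Idl A. \<forall>y\<in>X. (k \<otimes> a \<ominus> b) \<odot>\<^bsub>M\<^esub> y = \<zero>\<^bsub>M\<^esub>"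
      using step[OF I] by blast
    define J where "J = {a \<in> I. \<forall>y\<in>X. a \<odot>\<^bsub>M\<^esub> y = \<zero>\<^bsub>M\<^esub>}"
    have J: "ideal J R"
      unfolding J_def by (rule ideal_annihilating_elements[OF I X])
    obtain B where B: "finite B" "B \<subseteq> J"
      and B_gen: "\<And>a. a \<in> J \<Longrightarrow> \<exists>c\<in>Idl B. s \<odot>\<^bsub>M\<^esub> (a \<odot>\<^bsub>M\<^esub> x) = c \<odot>\<^bsub>M\<^esub> x"
      using ideal_finite_on_element[OF s_fin J x] by blast
    have AB: "A \<union> B \<subseteq> I"
      using A(2) B(2) by (auto simp: J_def)
    then have AB_carrier: "A \<union> B \<subseteq> carrier R"
      using I.Icarr by blast
    interpret AB: ideal "Idl (A \<union> B)" R
      by (rule genideal_ideal[OF AB_carrier])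
    have A_AB: "Idl A \<subseteq> Idl (A \<union> B)" and B_AB: "Idl B \<subseteq> Idl (A \<union> B)"
      by (rule subset_Idl_subset[OF AB_carrier]; blast)+
    have "\<exists>b\<in>Idl (A \<union> B). \<forall>y\<in>insert x X. ((s \<otimes> k) \<otimes> a \<ominus> b) \<odot>\<^bsub>M\<^esub> y = \<zero>\<^bsub>M\<^esub>"
      if a: "a \<in> I" for a
    proof -
      obtain b where b: "b \<in> Idl A" "\<forall>y\<in>X. (k \<otimes> a \<ominus> b) \<odot>\<^bsub>M\<^esub> y = \<zero>\<^bsub>M\<^esub>"
        using A_gen[OF a] by blast
      have bI: "b \<in> I"
        using genideal_minimal[OF I A(2)] b(1) by blast
      define d where "d = k \<otimes> a \<ominus> b"
      have d: "d \<in> J"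
        using a bI b(2) kR by (auto simp: J_def d_def a_minus_def I.I_l_closed)
      obtain c where c: "c \<in> Idl B" "s \<odot>\<^bsub>M\<^esub> (d \<odot>\<^bsub>M\<^esub> x) = c \<odot>\<^bsub>M\<^esub> x"
        using B_gen[OF d] by blast
      have cJ: "c \<in> J"
        using genideal_minimal[OF J B(2)] c(1) by blast
      have carr: "a \<in> carrier R" "b \<in> carrier R" "c \<in> carrier R" "d \<in> carrier R"
        using a bI cJ d I.Icarr by (auto simp: J_def)
      have eq: "(s \<otimes> k) \<otimes> a \<ominus> (s \<otimes> b \<oplus> c) = s \<otimes> d \<oplus> \<ominus> c"
        using carr sR kR unfolding d_def by algebra
      have expand: "((s \<otimes> k) \<otimes> a \<ominus> (s \<otimes> b \<oplus> c)) \<odot>\<^bsub>M\<^esub> y =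
          s \<odot>\<^bsub>M\<^esub> (d \<odot>\<^bsub>M\<^esub> y) \<oplus>\<^bsub>M\<^esub> \<ominus>\<^bsub>M\<^esub> (c \<odot>\<^bsub>M\<^esub> y)" if "y \<in> carrier M" for y
        unfolding eq using that carr sR by (simp add: smult_l_distr smult_assoc1 smult_l_minus)
      \<comment> \<open>At \<open>x\<close> the two terms cancel by the choice of \<open>c\<close>; on \<open>X\<close> both vanish, since
        \<open>c\<close> and \<open>d\<close> lie in \<open>J\<close>.\<close>
      have "((s \<otimes> k) \<otimes> a \<ominus> (s \<otimes> b \<oplus> c)) \<odot>\<^bsub>M\<^esub> y = \<zero>\<^bsub>M\<^esub>" if "y \<in> insert x X" for y
      proof (cases "y = x")
        case True
        then show ?thesis
          using expand[OF x] c(2) carr x by (simp add: M.r_neg)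
      next
        case False
        then show ?thesis
          using that expand[of y] X cJ d sR by (auto simp: J_def)
      qed
      moreover have "s \<otimes> b \<oplus> c \<in> Idl (A \<union> B)"
        using b(1) c(1) A_AB B_AB sR by (blast intro: AB.I_l_closed)
      ultimately show ?thesis by blast
    qed
    then show ?thesis
      using A(1) B(1) AB by (intro exI[of _ "A \<union> B"]) auto
  qed
  then show ?case
    using submonoid.m_closed[OF S s k] by blast
qed

section \<open>From a faithful module to the ring\<close>

theorem theorem2p8:
  fixes R :: "('a, 'm) ring_scheme"
    and M :: "('a, 'b, 'n) module_scheme"
    and S :: "'a set"
  assumes "cring R"
    and "submonoid S R"
    and "module R M"
    and "S_faithful R S M"
    and "uniformly_S_Noetherian R S M"
  shows "uniformly_S_Noetherian_ring R S"
proof -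
  interpret module R M by (rule assms(3))
  interpret N: module R "regular_module R" by (rule module_regular_module)
  interpret S: submonoid S R by (rule assms(2))
  obtain t where t: "t \<in> S" and faithful: "\<And>r. r \<in> annihilator R M \<Longrightarrow> t \<otimes>\<^bsub>R\<^esub> r = \<zero>\<^bsub>R\<^esub>"
    using assms(4) unfolding S_faithful_def by (metis imageI singletonD)
  obtain s where s: "s \<in> S" and s_fin: "\<And>H. submodule H R M \<Longrightarrow> s_finite R s (M\<lparr>carrier := H\<rparr>)"
    using assms(5) unfolding uniformly_S_Noetherian_def by blast
  obtain X where X: "finite X" "X \<subseteq> carrier M"
    and X_gen: "\<And>m. m \<in> carrier M \<Longrightarrow> s \<odot>\<^bsub>M\<^esub> m \<in> gen_submodule R M X"
    using s_fin[OF carrier_is_submodule]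
    unfolding s_finite_restrict_iff[OF carrier_is_submodule] by blast
  obtain k where k: "k \<in> S" and k_gen: "\<And>I. ideal I R \<Longrightarrow> \<exists>A. finite A \<and> A \<subseteq> I \<and>
      (\<forall>a\<in>I. \<exists>b\<in>Idl\<^bsub>R\<^esub> A. \<forall>x\<in>X. (k \<otimes>\<^bsub>R\<^esub> a \<ominus>\<^bsub>R\<^esub> b) \<odot>\<^bsub>M\<^esub> x = \<zero>\<^bsub>M\<^esub>)"
    using ideal_finite_modulo_annihilators[OF assms(2) s s_fin X] by blast
  have carr: "t \<in> carrier R" "s \<in> carrier R" "k \<in> carrier R"
    using t s k S.subset by auto
  have killed: "(t \<otimes>\<^bsub>R\<^esub> s) \<otimes>\<^bsub>R\<^esub> r = \<zero>\<^bsub>R\<^esub>"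
    if r: "r \<in> carrier R" and rX: "\<forall>x\<in>X. r \<odot>\<^bsub>M\<^esub> x = \<zero>\<^bsub>M\<^esub>" for r
  proof -
    have "gen_submodule R M X \<subseteq> {m \<in> carrier M. r \<odot>\<^bsub>M\<^esub> m = \<zero>\<^bsub>M\<^esub>}"
      using X(2) rX by (intro gen_submodule_least submodule_killed_by r) auto
    then have "(s \<otimes>\<^bsub>R\<^esub> r) \<odot>\<^bsub>M\<^esub> m = \<zero>\<^bsub>M\<^esub>" if "m \<in> carrier M" for m
      using X_gen[OF that] that r carr by (auto simp: R.m_comm[of s r] smult_assoc1)
    then have "s \<otimes>\<^bsub>R\<^esub> r \<in> annihilator R M"
      using r carr by (simp add: annihilator_def)
    from faithful[OF this] show ?thesis
      using r carr by (simp add: R.m_assoc)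
  qed
  have "s_finite R ((t \<otimes>\<^bsub>R\<^esub> s) \<otimes>\<^bsub>R\<^esub> k) ((regular_module R)\<lparr>carrier := I\<rparr>)"
    if I: "submodule I R (regular_module R)" for I
  proof -
    have I': "ideal I R"
      using I by (simp add: submodule_regular_module_iff)
    then interpret I: ideal I R .
    obtain A where A: "finite A" "A \<subseteq> I" and A_gen: "\<And>a. a \<in> I \<Longrightarrow>
        \<exists>b\<in>Idl\<^bsub>R\<^esub> A. \<forall>x\<in>X. (k \<otimes>\<^bsub>R\<^esub> a \<ominus>\<^bsub>R\<^esub> b) \<odot>\<^bsub>M\<^esub> x = \<zero>\<^bsub>M\<^esub>"
      using k_gen[OF I'] by blast
    interpret A: ideal "Idl\<^bsub>R\<^esub> A" R
      using A(2) I.Icarr by (intro genideal_ideal) auto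
    have "((t \<otimes>\<^bsub>R\<^esub> s) \<otimes>\<^bsub>R\<^esub> k) \<otimes>\<^bsub>R\<^esub> a \<in> Idl\<^bsub>R\<^esub> A" if a: "a \<in> I" for a
    proof -
      obtain b where b: "b \<in> Idl\<^bsub>R\<^esub> A" "\<forall>x\<in>X. (k \<otimes>\<^bsub>R\<^esub> a \<ominus>\<^bsub>R\<^esub> b) \<odot>\<^bsub>M\<^esub> x = \<zero>\<^bsub>M\<^esub>"
        using A_gen[OF a] by blast
      have ab: "a \<in> carrier R" "b \<in> carrier R"
        using a b(1) I.Icarr A.Icarr by auto
      have "((t \<otimes>\<^bsub>R\<^esub> s) \<otimes>\<^bsub>R\<^esub> k) \<otimes>\<^bsub>R\<^esub> a =
          (t \<otimes>\<^bsub>R\<^esub> s) \<otimes>\<^bsub>R\<^esub> (k \<otimes>\<^bsub>R\<^esub> a \<ominus>\<^bsub>R\<^esub> b) \<oplus>\<^bsub>R\<^esub> (t \<otimes>\<^bsub>R\<^esub> s) \<otimes>\<^bsub>R\<^esub> b"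
        using ab carr by algebra
      also have "\<dots> = (t \<otimes>\<^bsub>R\<^esub> s) \<otimes>\<^bsub>R\<^esub> b"
        using killed[OF _ b(2)] ab carr by simp
      finally show ?thesis
        using b(1) carr by (simp add: A.I_l_closed)
    qed
    then show ?thesis
      using A unfolding N.s_finite_restrict_iff[OF I] gen_submodule_regular_module
      by (auto simp: regular_module_def)
  qed
  moreover have "(t \<otimes>\<^bsub>R\<^esub> s) \<otimes>\<^bsub>R\<^esub> k \<in> S"
    using t s k by simp
  ultimately show ?thesis
    unfolding uniformly_S_Noetherian_ring_def uniformly_S_Noetherian_def by blast
qed

end
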